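(* Let $W=W_N$ be an $N\times N$ matrix drawn from the Gaussian Orthogonal Ensemble and let $J=\frac1{\sqrt N}W$. Then for every $0\le\beta<\frac12$, $$\frac1N\log\left(\frac1{2^N}\sum_{\sigma\in\{-1,+1\}^N}\exp\big(\beta\,\sigma^TJ\sigma\big)\right)\longrightarrow\beta^2\qquad\text{in probability as }N\to\infty .$$
   Context: The Gaussian Orthogonal Ensemble is normalized so that $W$ is symmetric with independent centered Gaussian entries on and above the diagonal, off-diagonal entries having variance $1$ and diagonal entries variance $2$; with this normalization the empirical spectral distribution of $J$ converges to the semicircle law with density $\frac{\sqrt{4-x^2}}{2\pi}$ on $[-2,2]$. This is the Sherrington–Kirkpatrick (SK) model. *)

theory Defs
  imports "HOL-Probability.Probability"
begin

text \<open>
  An \<open>N\<close> by \<open>N\<close> matrix is a function \<open>nat \<Rightarrow> nat \<Rightarrow> real\<close> of which only the entries with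
  indices below \<open>N\<close> are relevant, and \<open>W i j \<omega>\<close> is the \<open>(i, j)\<close> entry of the random matrix
  \<open>W\<close>. The second parameter of \<^const>\<open>normal_density\<close> is the standard deviation, so the
  diagonal entries have variance 2 and the off-diagonal ones variance 1.
\<close>

definition GOE :: "nat \<Rightarrow> 'a measure \<Rightarrow> (nat \<Rightarrow> nat \<Rightarrow> 'a \<Rightarrow> real) \<Rightarrow> bool" where
  "GOE N M W \<longleftrightarrow>
     prob_space M \<and>
     (\<forall>\<omega>\<in>space M. \<forall>i<N. \<forall>j<N. W i j \<omega> = W j i \<omega>) \<and>
     prob_space.indep_vars M (\<lambda>_. borel) (\<lambda>(i, j). W i j) {(i, j). i \<le> j \<and> j < N} \<and>
     (\<forall>i j. i \<le> j \<and> j < N \<longrightarrow>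
        distributed M lborel (W i j)
          (\<lambda>x. ennreal (normal_density 0 (if i = j then sqrt 2 else 1) x)))"

definition normalized :: "nat \<Rightarrow> (nat \<Rightarrow> nat \<Rightarrow> real) \<Rightarrow> (nat \<Rightarrow> nat \<Rightarrow> real)" where
  "normalized N A = (\<lambda>i j. A i j / sqrt (real N))"

definition spins :: "nat \<Rightarrow> (nat \<Rightarrow> real) set" where
  "spins N = {..<N} \<rightarrow>\<^sub>E {-1, 1}"

definition quad_form :: "nat \<Rightarrow> (nat \<Rightarrow> nat \<Rightarrow> real) \<Rightarrow> (nat \<Rightarrow> real) \<Rightarrow> real" where
  "quad_form N A \<sigma> = (\<Sum>i<N. \<Sum>j<N. \<sigma> i * A i j * \<sigma> j)"

definition free_energy :: "nat \<Rightarrow> real \<Rightarrow> (nat \<Rightarrow> nat \<Rightarrow> real) \<Rightarrow> real" where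
  "free_energy N \<beta> A =
     1 / real N * ln (1 / 2 ^ N * (\<Sum>\<sigma>\<in>spins N. exp (\<beta> * quad_form N A \<sigma>)))"

text \<open>
  Convergence in probability to a constant. The probability space may depend on the index.
\<close>

definition tendsto_in_prob ::
  "(nat \<Rightarrow> 'a measure) \<Rightarrow> (nat \<Rightarrow> 'a \<Rightarrow> real) \<Rightarrow> real \<Rightarrow> bool" where
  "tendsto_in_prob M X c \<longleftrightarrow>
     (\<forall>n. X n \<in> borel_measurable (M n)) \<and>
     (\<forall>\<epsilon>>0. (\<lambda>n. measure (M n) {\<omega> \<in> space (M n). \<bar>X n \<omega> - c\<bar> > \<epsilon>}) \<longlonglongrightarrow> 0)"

end

theory Submission
  imports Defs "HOL-Real_Asymp.Real_Asymp"
begin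

text \<open>
  Write \<open>Z\<close> for the normalized partition sum, so that the free energy is \<open>F = ln Z / N\<close>.
  Gaussian exponential moments give \<open>E Z = exp (\<beta>\<^sup>2 N)\<close>, and \<open>E Z\<^sup>2 / (E Z)\<^sup>2\<close> is the average of
  \<open>exp (2 \<beta>\<^sup>2 S\<^sup>2 / N)\<close> over the overlap \<open>S\<close> of two uniform spin configurations, a sum of \<open>N\<close> fair
  signs; this stays bounded exactly because \<open>4 \<beta>\<^sup>2 < 1\<close>. Hence \<open>Z \<ge> E Z / 2\<close> with probability
  bounded away from 0. On the other hand \<open>F\<close> is Lipschitz in each of the \<open>O(N\<^sup>2)\<close> independent entries
  with constant \<open>2 \<beta> / N\<^bsup>3/2\<^esup>\<close>, so its variance is \<open>O(1 / N)\<close> by the Efron-Stein inequality.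
  Concentration around the mean turns the positive probability into the lower bound
  \<open>E F \<ge> \<beta>\<^sup>2 - o(1)\<close>; the upper tail is Markov's inequality for \<open>Z\<close>.
\<close>

section \<open>The Efron-Stein inequality for Lipschitz functions\<close>

text \<open>The mean minimizes the mean square distance to a constant, so the variance of
  \<open>f\<close> is at most its mean square distance to \<open>c\<close>, which is bounded
  pointwise. Comparing with one fixed value avoids an independent copy of \<open>X\<close>.\<close>

lemma (in prob_space) variance_lipschitz_le:
  fixes X f :: "'a \<Rightarrow> real"
  assumes X [measurable]: "X \<in> borel_measurable M" and X2: "integrable M (\<lambda>x. (X x)\<^sup>2)"
    and f [measurable]: "f \<in> borel_measurable M" and f2: "integrable M (\<lambda>x. (f x)\<^sup>2)"
    and lip: "\<And>x. x \<in> space M \<Longrightarrow> \<bar>f x - c\<bar> \<le> L * \<bar>X x - expectation X\<bar>"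
  shows "variance f \<le> L\<^sup>2 * variance X"
proof -
  have [simp]: "integrable M X" "integrable M f"
    using X2 f2 by (blast intro: square_integrable_imp_integrable X f)+
  have intX: "integrable M (\<lambda>x. L\<^sup>2 * (X x - expectation X)\<^sup>2)"
    using X2 by (simp add: power2_diff)
  have "variance f \<le> variance f + (expectation f - c)\<^sup>2"
    by simp
  also have "\<dots> = expectation (\<lambda>x. (f x - c)\<^sup>2)"
    using f2 by (simp add: variance_eq power2_diff prob_space algebra_simps) (simp add: power2_eq_square)
  also have "\<dots> \<le> expectation (\<lambda>x. L\<^sup>2 * (X x - expectation X)\<^sup>2)"
  proof (rule integral_mono'[OF intX])
    fix x assume "x \<in> space M"
    from lip[OF this] have "\<bar>f x - c\<bar>\<^sup>2 \<le> (L * \<bar>X x - expectation X\<bar>)\<^sup>2"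
      by (intro power_mono) auto
    then show "(f x - c)\<^sup>2 \<le> L\<^sup>2 * (X x - expectation X)\<^sup>2"
      by (simp add: power_mult_distrib)
  qed simp
  finally show ?thesis by simp
qed

text \<open>Comparison with the value at the origin \<open>z\<close>: the square of
  \<open>f x\<close> is at most twice that of \<open>f z\<close> plus twice that of the difference,
  and Cauchy-Schwarz bounds the squared l1 norm by \<open>card I\<close> times the sum of squares.
  This justifies Fubini in the induction below.\<close>

lemma square_integrable_of_lipschitz:
  fixes P :: "'i \<Rightarrow> real measure"
  assumes fin: "finite I" and prob: "\<And>i. prob_space (P i)" and sets: "\<And>i. sets (P i) = sets borel"
    and sq: "\<And>i. integrable (P i) (\<lambda>x. x\<^sup>2)"
    and f [measurable]: "f \<in> borel_measurable (PiM I P)"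
    and lip: "\<And>x y. x \<in> space (PiM I P) \<Longrightarrow> y \<in> space (PiM I P) \<Longrightarrow>
      \<bar>f x - f y\<bar> \<le> L * (\<Sum>i\<in>I. \<bar>x i - y i\<bar>)"
  shows "integrable (PiM I P) (\<lambda>x. (f x)\<^sup>2 :: real)"
proof -
  interpret finite_product_prob_space P I
    using fin prob by (simp add: finite_product_prob_space_def finite_product_sigma_finite_def
        product_prob_space_def product_prob_space_axioms_def finite_product_sigma_finite_axioms_def
        product_sigma_finite_def prob_space_imp_sigma_finite)
  have [simp]: "space (P i) = UNIV" for i
    using sets_eq_imp_space_eq[OF sets[of i]] by simp
  define z :: "'i \<Rightarrow> real" where "z = (\<lambda>i\<in>I. 0)"
  have z: "z \<in> space (PiM I P)"
    by (auto simp: z_def space_PiM)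
  have sq': "integrable (PiM I P) (\<lambda>x. (x i)\<^sup>2)" if "i \<in> I" for i
  proof -
    have [measurable]: "(\<lambda>x. x i) \<in> measurable (PiM I P) (P i)"
      using that by (rule measurable_component_singleton)
    have "integrable (distr (PiM I P) (P i) (\<lambda>x. x i)) (\<lambda>x. x\<^sup>2)"
      using sq[of i] by (subst distr_PiM_component[where M = P, OF prob that]) auto
    then show ?thesis
      by (subst (asm) integrable_distr_eq) (auto simp: measurable_cong_sets[OF sets refl])
  qed
  define g where "g x = 2 * (f z)\<^sup>2 + 2 * L\<^sup>2 * (real (card I) * (\<Sum>i\<in>I. (x i)\<^sup>2))" for x
  have "integrable (PiM I P) g"
    unfolding g_def using sq' by (intro Bochner_Integration.integrable_add integrable_mult_right) auto
  then show ?thesis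
  proof (rule Bochner_Integration.integrable_bound)
    show "AE x in PiM I P. norm ((f x)\<^sup>2) \<le> norm (g x)"
    proof (rule AE_I2)
      fix x assume x: "x \<in> space (PiM I P)"
      have "\<bar>f x - f z\<bar> \<le> L * (\<Sum>i\<in>I. \<bar>x i\<bar>)"
        using lip[OF x z] by (simp add: z_def)
      then have "\<bar>f x - f z\<bar>\<^sup>2 \<le> (L * (\<Sum>i\<in>I. \<bar>x i\<bar>))\<^sup>2"
        by (intro power_mono) auto
      also have "\<dots> \<le> L\<^sup>2 * (real (card I) * (\<Sum>i\<in>I. (x i)\<^sup>2))"
        using sum_squared_le_sum_of_squares[of "\<lambda>i. \<bar>x i\<bar>" I] fin
        by (auto simp: power_mult_distrib mult.commute intro!: mult_left_mono)
      finally have "(f x - f z)\<^sup>2 \<le> L\<^sup>2 * (real (card I) * (\<Sum>i\<in>I. (x i)\<^sup>2))"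
        by simp
      moreover have "(f x)\<^sup>2 \<le> 2 * (f z)\<^sup>2 + 2 * (f x - f z)\<^sup>2"
        using sum_squares_bound[of "f z" "f x - f z"] by (simp add: power2_eq_square algebra_simps)
      ultimately have "(f x)\<^sup>2 \<le> g x"
        by (simp add: g_def)
      then show "norm ((f x)\<^sup>2) \<le> norm (g x)"
        by simp
    qed
  qed simp
qed

text \<open>The law of total variance, applied one coordinate at a time. Given the other
  coordinates, the conditional variance is bounded by the one-dimensional lemma; the conditional
  mean is again Lipschitz with the same \<open>L\<close>, so the induction hypothesis, available for
  every function, applies to it.\<close>

lemma Efron_Stein_PiM:
  fixes P :: "'i \<Rightarrow> real measure"
  assumes fin: "finite I" and prob: "\<And>i. prob_space (P i)" and sets: "\<And>i. sets (P i) = sets borel"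
    and sq: "\<And>i. integrable (P i) (\<lambda>x. x\<^sup>2)"
    and f: "f \<in> borel_measurable (PiM I P)"
    and lip: "\<And>x y. x \<in> space (PiM I P) \<Longrightarrow> y \<in> space (PiM I P) \<Longrightarrow>
      \<bar>f x - f y\<bar> \<le> L * (\<Sum>i\<in>I. \<bar>x i - y i\<bar>)"
  shows "(\<integral>x. (f x)\<^sup>2 \<partial>PiM I P) - (\<integral>x. f x \<partial>PiM I P)\<^sup>2
    \<le> L\<^sup>2 * (\<Sum>i\<in>I. prob_space.variance (P i) (\<lambda>x. x))"
  using fin f lip
proof (induction I arbitrary: f)
  case empty
  then show ?case
    by (simp add: PiM_empty lebesgue_integral_count_space_finite)
next
  case (insert i I)
  interpret S: product_sigma_finite P
    using prob by (simp add: product_sigma_finite_def prob_space_imp_sigma_finite)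
  interpret Pi: prob_space "P i" by (rule prob)
  interpret PI: prob_space "PiM I P" by (intro prob_space_PiM prob)
  interpret PiI: prob_space "PiM (insert i I) P" by (intro prob_space_PiM prob)
  have [simp]: "space (P i) = UNIV" for i
    using sets_eq_imp_space_eq[OF sets[of i]] by simp
  note [measurable_cong] = sets
  note f [measurable] = insert.prems(1)
  have upd: "x(i := y) \<in> space (PiM (insert i I) P)" if "x \<in> space (PiM I P)" for x y
    using that by (auto simp: space_PiM PiE_def extensional_def)
  have upd_sum: "(\<Sum>j\<in>insert i I. \<bar>(x(i := s)) j - (y(i := t)) j\<bar>) = \<bar>s - t\<bar> + (\<Sum>j\<in>I. \<bar>x j - y j\<bar>)"
    for x y :: "'i \<Rightarrow> real" and s t
    using insert.hyps by simp (intro sum.cong, auto)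
  have upd_lip: "\<bar>f (x(i := s)) - f (y(i := t))\<bar> \<le> L * (\<bar>s - t\<bar> + (\<Sum>j\<in>I. \<bar>x j - y j\<bar>))"
    if "x \<in> space (PiM I P)" "y \<in> space (PiM I P)" for x y s t
    by (rule order_trans[OF insert.prems(2)[OF upd upd]]) (use that in \<open>simp_all only: upd_sum order_refl\<close>)
  have f2: "integrable (PiM (insert i I) P) (\<lambda>x. (f x)\<^sup>2)"
    using insert.hyps insert.prems
    by (intro square_integrable_of_lipschitz[where L = L] prob sets sq) auto
  have f1: "integrable (PiM (insert i I) P) f"
    by (rule PiI.square_integrable_imp_integrable[OF f f2])
  have sec_m: "(\<lambda>y. f (x(i := y))) \<in> borel_measurable (P i)" if "x \<in> space (PiM I P)" for x
    using measurable_comp[OF measurable_component_update f, OF that insert.hyps(2)]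
    unfolding comp_def .
  have sec_lip: "\<bar>f (x(i := s)) - f (x(i := t))\<bar> \<le> L * \<bar>s - t\<bar>" if "x \<in> space (PiM I P)" for x s t
    using upd_lip[OF that that, of s t] by simp
  have sec2: "integrable (P i) (\<lambda>y. (f (x(i := y)))\<^sup>2)" if x: "x \<in> space (PiM I P)" for x
  proof -
    \<comment> \<open>The square of a section is dominated through its value at 0 and the square of
      the new coordinate.\<close>
    have "integrable (P i) (\<lambda>y. 2 * (f (x(i := 0)))\<^sup>2 + 2 * (L\<^sup>2 * y\<^sup>2))"
      using sq by auto
    then show ?thesis
    proof (rule Bochner_Integration.integrable_bound)
      show "AE y in P i. norm ((f (x(i := y)))\<^sup>2) \<le> norm (2 * (f (x(i := 0)))\<^sup>2 + 2 * (L\<^sup>2 * y\<^sup>2))"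
      proof (rule AE_I2)
        fix y
        let ?d = "f (x(i := y)) - f (x(i := 0))"
        have "\<bar>?d\<bar>\<^sup>2 \<le> (L * \<bar>y\<bar>)\<^sup>2"
          using sec_lip[OF x, of y 0] by (intro power_mono) auto
        then have "?d\<^sup>2 \<le> L\<^sup>2 * y\<^sup>2"
          by (simp add: power_mult_distrib)
        moreover have "(f (x(i := y)))\<^sup>2 \<le> 2 * (f (x(i := 0)))\<^sup>2 + 2 * ?d\<^sup>2"
          using sum_squares_bound[of "f (x(i := 0))" ?d] by (simp add: power2_eq_square algebra_simps)
        ultimately show "norm ((f (x(i := y)))\<^sup>2) \<le> norm (2 * (f (x(i := 0)))\<^sup>2 + 2 * (L\<^sup>2 * y\<^sup>2))"
          by simp
      qed
    qed (use sec_m[OF x] in simp)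
  qed
  have sec1: "integrable (P i) (\<lambda>y. f (x(i := y)))" if "x \<in> space (PiM I P)" for x
    by (rule Pi.square_integrable_imp_integrable[OF sec_m[OF that] sec2[OF that]])
  \<comment> \<open>This is the conditional expectation of \<open>f\<close> given the coordinates in
    \<open>I\<close>.\<close>
  define g where "g x = (\<integral>y. f (x(i := y)) \<partial>P i)" for x
  have g [measurable]: "g \<in> borel_measurable (PiM I P)"
  proof -
    have "(\<lambda>(x, y). f (x(i := y))) \<in> borel_measurable (PiM I P \<Otimes>\<^sub>M P i)"
      using measurable_comp[OF measurable_add_dim f] by (simp add: comp_def case_prod_beta')
    then show ?thesis
      unfolding g_def by (rule sigma_finite_measure.borel_measurable_lebesgue_integral[OF prob_space_imp_sigma_finite[OF prob]])
  qed
  \<comment> \<open>Both arguments receive the same value \<open>t\<close> in coordinate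
    \<open>i\<close>, so that coordinate drops out of the Lipschitz bound before averaging.\<close>
  have g_lip: "\<bar>g x - g y\<bar> \<le> L * (\<Sum>j\<in>I. \<bar>x j - y j\<bar>)"
    if x: "x \<in> space (PiM I P)" and y: "y \<in> space (PiM I P)" for x y
  proof -
    have "\<bar>g x - g y\<bar> = \<bar>\<integral>t. f (x(i := t)) - f (y(i := t)) \<partial>P i\<bar>"
      using sec1 x y by (simp add: g_def)
    also have "\<dots> \<le> (\<integral>t. \<bar>f (x(i := t)) - f (y(i := t))\<bar> \<partial>P i)"
      using integral_norm_bound[of "P i" "\<lambda>t. f (x(i := t)) - f (y(i := t))"] by simp
    also have "\<dots> \<le> (\<integral>t. L * (\<Sum>j\<in>I. \<bar>x j - y j\<bar>) \<partial>P i)"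
    proof (rule integral_mono)
      fix t
      show "\<bar>f (x(i := t)) - f (y(i := t))\<bar> \<le> L * (\<Sum>j\<in>I. \<bar>x j - y j\<bar>)"
        using upd_lip[OF x y, of t t] by simp
    qed (use sec1 x y in auto)
    finally show ?thesis
      using Pi.prob_space by simp
  qed
  have g2: "integrable (PiM I P) (\<lambda>x. (g x)\<^sup>2)"
    using insert.hyps g g_lip
    by (intro square_integrable_of_lipschitz[where L = L] prob sets sq) auto
  let ?v = "L\<^sup>2 * Pi.variance (\<lambda>x. x)"
  have v_nonneg: "0 \<le> ?v"
    by simp
  \<comment> \<open>By Fubini the second moment is the mean of the inner one, and the inner one is
    the conditional variance plus the square of \<open>g x\<close>.\<close>
  have "(\<integral>x. (f x)\<^sup>2 \<partial>PiM (insert i I) P) = (\<integral>x. (\<integral>y. (f (x(i := y)))\<^sup>2 \<partial>P i) \<partial>PiM I P)"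
    using insert.hyps f2 by (rule S.product_integral_insert)
  also have "\<dots> \<le> (\<integral>x. (g x)\<^sup>2 + ?v \<partial>PiM I P)"
  proof (rule integral_mono')
    show "integrable (PiM I P) (\<lambda>x. (g x)\<^sup>2 + ?v)"
      using g2 by auto
    fix x assume x: "x \<in> space (PiM I P)"
    \<comment> \<open>The section is compared with its value at the mean of coordinate
      \<open>i\<close>.\<close>
    have "Pi.variance (\<lambda>y. f (x(i := y))) \<le> ?v"
      using sec_m[OF x] sec2[OF x] sec_lip[OF x] sq
      by (intro Pi.variance_lipschitz_le[where c = "f (x(i := Pi.expectation (\<lambda>x. x)))"]) auto
    moreover have "Pi.variance (\<lambda>y. f (x(i := y))) = (\<integral>y. (f (x(i := y)))\<^sup>2 \<partial>P i) - (g x)\<^sup>2"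
      using sec1[OF x] sec2[OF x] by (subst Pi.variance_eq) (auto simp: g_def)
    ultimately show "(\<integral>y. (f (x(i := y)))\<^sup>2 \<partial>P i) \<le> (g x)\<^sup>2 + ?v"
      by simp
  qed (use v_nonneg in auto)
  also have "\<dots> = (\<integral>x. (g x)\<^sup>2 \<partial>PiM I P) + ?v"
    using g2 by (simp add: PI.prob_space)
  finally have "(\<integral>x. (f x)\<^sup>2 \<partial>PiM (insert i I) P) \<le> (\<integral>x. (g x)\<^sup>2 \<partial>PiM I P) + ?v" .
  moreover have "(\<integral>x. f x \<partial>PiM (insert i I) P) = (\<integral>x. g x \<partial>PiM I P)"
    unfolding g_def using insert.hyps f1 by (rule S.product_integral_insert)
  moreover have "(\<integral>x. (g x)\<^sup>2 \<partial>PiM I P) - (\<integral>x. g x \<partial>PiM I P)\<^sup>2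
      \<le> L\<^sup>2 * (\<Sum>i\<in>I. prob_space.variance (P i) (\<lambda>x. x))"
    by (rule insert.IH[OF g g_lip])
  ultimately show ?case
    using insert.hyps by (simp add: algebra_simps)
qed

text \<open>Independence makes the joint law of the \<open>X i\<close> a product measure, to which
  the product version applies.\<close>

lemma (in prob_space) Efron_Stein:
  fixes X :: "'i \<Rightarrow> 'a \<Rightarrow> real"
  assumes fin: "finite I" and indep: "indep_vars (\<lambda>_. borel) X I"
    and sq: "\<And>i. i \<in> I \<Longrightarrow> integrable M (\<lambda>\<omega>. (X i \<omega>)\<^sup>2)"
    and f [measurable]: "f \<in> borel_measurable (PiM I (\<lambda>_. borel))"
    and lip: "\<And>x y. \<bar>f x - f y\<bar> \<le> L * (\<Sum>i\<in>I. \<bar>x i - y i\<bar>)"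
    and F: "\<And>\<omega>. \<omega> \<in> space M \<Longrightarrow> F \<omega> = f (\<lambda>i\<in>I. X i \<omega>)"
  shows "integrable M (\<lambda>\<omega>. (F \<omega>)\<^sup>2)" and "variance F \<le> L\<^sup>2 * (\<Sum>i\<in>I. variance (X i))"
proof -
  \<comment> \<open>Extending by 0 outside \<open>I\<close> makes every marginal \<open>P i\<close>
    a square integrable probability law, as the product version demands for all indices.\<close>
  define Y where "Y i \<omega> = (if i \<in> I then X i \<omega> else 0)" for i \<omega>
  have Y [measurable]: "Y i \<in> borel_measurable M" for i
    unfolding Y_def using indep by (cases "i \<in> I") (auto simp: indep_vars_def)
  define T where "T \<omega> = (\<lambda>i\<in>I. Y i \<omega>)" for \<omega>
  have T [measurable]: "T \<in> measurable M (PiM I (\<lambda>_. borel))"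
    unfolding T_def by measurable
  define P where "P i = distr M borel (Y i)" for i
  have P: "prob_space (P i)" "sets (P i) = sets borel" for i
    by (auto simp: P_def intro!: prob_space_distr)
  have sets_PiM: "sets (PiM I P) = sets (PiM I (\<lambda>_. borel))"
    by (intro sets_PiM_cong) (auto simp: P)
  have "integrable M (\<lambda>\<omega>. (Y i \<omega>)\<^sup>2)" for i
    by (cases "i \<in> I") (auto simp: Y_def sq)
  then have P_sq: "integrable (P i) (\<lambda>x. x\<^sup>2)" for i
    by (simp add: P_def integrable_distr_eq)
  have indepY: "indep_vars (\<lambda>_. borel) Y I"
    using indep by (subst indep_vars_cong[OF refl, where Y = X and N' = "\<lambda>_. borel"]) (auto simp: Y_def)
  \<comment> \<open>The characterization of independence by product laws is applied to nonempty
    \<open>I\<close>; with no coordinates both sides are the probability measure on a single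
    point.\<close>
  have distr: "distr M (PiM I (\<lambda>_. borel)) T = PiM I P"
  proof (cases "I = {}")
    case True
    then show ?thesis
      using prob_space.emeasure_space_1[OF prob_space_distr[OF T]]
      by (intro measure_eqI) (auto simp: PiM_empty subset_singleton_iff)
  next
    case False
    from indep_vars_iff_distr_eq_PiM[OF this, where M' = "\<lambda>_. borel" and X = Y] indepY show ?thesis
      by (simp add: T_def[abs_def] P_def[abs_def])
  qed
  have fP: "f \<in> borel_measurable (PiM I P)"
    using f by (simp add: measurable_cong_sets[OF sets_PiM refl])
  have FT: "F \<omega> = f (T \<omega>)" if "\<omega> \<in> space M" for \<omega>
    using F[OF that] by (simp add: T_def Y_def cong: restrict_cong)
  have "integrable (PiM I P) (\<lambda>x. (f x)\<^sup>2)"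
    by (rule square_integrable_of_lipschitz[where L = L]) (use fin P P_sq fP lip in auto)
  then have fT2: "integrable M (\<lambda>\<omega>. (f (T \<omega>))\<^sup>2)"
    by (simp add: distr[symmetric] integrable_distr_eq)
  then show "integrable M (\<lambda>\<omega>. (F \<omega>)\<^sup>2)"
    by (simp add: FT cong: Bochner_Integration.integrable_cong)
  have fT1: "integrable M (\<lambda>\<omega>. f (T \<omega>))"
    using fT2 by (rule square_integrable_imp_integrable[rotated]) measurable
  have "variance F = variance (\<lambda>\<omega>. f (T \<omega>))"
    by (simp add: FT cong: Bochner_Integration.integral_cong)
  also have "\<dots> = (\<integral>x. (f x)\<^sup>2 \<partial>PiM I P) - (\<integral>x. f x \<partial>PiM I P)\<^sup>2"
    using fT1 fT2 by (simp add: variance_eq distr[symmetric] integral_distr)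
  also have "\<dots> \<le> L\<^sup>2 * (\<Sum>i\<in>I. prob_space.variance (P i) (\<lambda>x. x))"
    by (rule Efron_Stein_PiM) (use fin P P_sq fP lip in auto)
  also have "(\<Sum>i\<in>I. prob_space.variance (P i) (\<lambda>x. x)) = (\<Sum>i\<in>I. variance (X i))"
    by (intro sum.cong refl) (simp add: P_def integral_distr, simp add: Y_def[abs_def])
  finally show "variance F \<le> L\<^sup>2 * (\<Sum>i\<in>I. variance (X i))" .
qed

section \<open>Spin sums\<close>

text \<open>The derivative of \<open>x\<^sup>2 / 2 - ln (cosh x)\<close> is
  \<open>x - tanh x\<close>, which is nonnegative for \<open>x \<ge> 0\<close> because its own
  derivative is the square of \<open>tanh x\<close>. Evenness gives negative \<open>x\<close>.
  Probabilistically this is the subgaussian bound for a fair sign.\<close>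

lemma cosh_le_exp_half_sq: "cosh x \<le> exp (x\<^sup>2 / 2)" for x :: real
proof -
  have tanh: "tanh t \<le> t" if "0 \<le> t" for t :: real
  proof -
    have "0 - tanh (0::real) \<le> t - tanh t"
    proof (rule DERIV_nonneg_imp_nondecreasing[OF that])
      fix s :: real
      have "((\<lambda>s. s - tanh s) has_real_derivative (tanh s)\<^sup>2) (at s)"
        by (auto intro!: derivative_eq_intros)
      then show "\<exists>y. ((\<lambda>s. s - tanh s) has_real_derivative y) (at s) \<and> 0 \<le> y"
        by force
    qed
    then show ?thesis by simp
  qed
  have pos: "cosh t \<le> exp (t\<^sup>2 / 2)" if "0 \<le> t" for t :: real
  proof -
    have "0\<^sup>2 / 2 - ln (cosh (0::real)) \<le> t\<^sup>2 / 2 - ln (cosh t)"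
    proof (rule DERIV_nonneg_imp_nondecreasing[OF that])
      fix s :: real assume "0 \<le> s"
      have "((\<lambda>s. s\<^sup>2 / 2 - ln (cosh s)) has_real_derivative (s - tanh s)) (at s)"
        by (auto intro!: derivative_eq_intros simp: tanh_def cosh_real_pos field_simps)
      with tanh[OF \<open>0 \<le> s\<close>]
      show "\<exists>y. ((\<lambda>s. s\<^sup>2 / 2 - ln (cosh s)) has_real_derivative y) (at s) \<and> 0 \<le> y"
        by force
    qed
    then have "ln (cosh t) \<le> t\<^sup>2 / 2"
      by simp
    then show ?thesis
      by (metis cosh_real_pos exp_le_cancel_iff exp_ln)
  qed
  show ?thesis
    using pos[of x] pos[of "- x"] by (cases "0 \<le> x") auto
qed

lemma finite_spins [simp]: "finite (spins N)"
  by (simp add: spins_def finite_PiE)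

lemma card_spins: "card (spins N) = 2 ^ N"
  by (simp add: spins_def card_PiE numeral_2_eq_2)

lemma spins_nonempty: "spins N \<noteq> {}"
  by (simp add: spins_def PiE_eq_empty_iff)

lemma spins_sq: "\<sigma> \<in> spins N \<Longrightarrow> i < N \<Longrightarrow> (\<sigma> i)\<^sup>2 = 1"
  by (auto simp: spins_def PiE_def Pi_def)

lemma abs_spins: "\<sigma> \<in> spins N \<Longrightarrow> i < N \<Longrightarrow> \<bar>\<sigma> i\<bar> = 1"
  by (auto simp: spins_def PiE_def Pi_def)

lemma sum_spins_Suc:
  "(\<Sum>\<sigma>\<in>spins (Suc n). h \<sigma>) = (\<Sum>\<sigma>\<in>spins n. h (\<sigma>(n := -1)) + h (\<sigma>(n := 1)))"
  for h :: "_ \<Rightarrow> real"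
proof -
  have "spins (Suc n) = (\<lambda>(y, \<sigma>). \<sigma>(n := y)) ` ({-1, 1} \<times> spins n)"
    by (simp add: spins_def lessThan_Suc PiE_insert_eq)
  moreover have "inj_on (\<lambda>(y, \<sigma>). \<sigma>(n := y)) ({-1, 1} \<times> spins n)"
    unfolding spins_def by (rule inj_combinator) simp
  ultimately have "(\<Sum>\<sigma>\<in>spins (Suc n). h \<sigma>) = (\<Sum>(y, \<sigma>)\<in>{-1, 1} \<times> spins n. h (\<sigma>(n := y)))"
    by (simp add: sum.reindex case_prod_beta')
  then show ?thesis
    by (simp add: sum.cartesian_product[symmetric] sum.distrib)
qed

text \<open>Summing out one spin replaces the coefficient \<open>c\<close> of the square by \<open>c + 2 c\<^sup>2 \<le> c / (1 - 2 c)\<close>,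
  and the map \<open>c \<mapsto> c / (1 - 2 c)\<close> iterates to \<open>a / (1 - 2 a n)\<close>.\<close>

lemma sum_spins_exp_square_le:
  fixes a s :: real
  assumes "0 \<le> a" and "2 * a * real n < 1" and "\<And>i. i < n \<Longrightarrow> \<bar>\<tau> i\<bar> = 1"
  shows "(\<Sum>\<sigma>\<in>spins n. exp (a * (s + (\<Sum>i<n. \<tau> i * \<sigma> i))\<^sup>2))
    \<le> 2 ^ n * exp (a / (1 - 2 * a * real n) * (real n + s\<^sup>2))"
  \<comment> \<open>The shift \<open>s\<close> must be arbitrary in the induction: fixing the last
    spin moves it by plus or minus \<open>\<tau> n\<close>.\<close>
  using assms(2,3)
proof (induction n arbitrary: s)
  case 0
  then show ?case by (simp add: spins_def)
next
  case (Suc n)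
  let ?S = "\<lambda>\<sigma>. \<Sum>i<n. \<tau> i * \<sigma> i"
  define c where "c = a / (1 - 2 * a * real n)"
  define d where "d = a / (1 - 2 * a * real (Suc n))"
  from Suc.prems(1) assms(1) have lt: "2 * a * real n + 2 * a < 1"
    by (simp add: algebra_simps)
  then have lt': "2 * a * real n < 1"
    using assms(1) by linarith
  have c: "0 \<le> c" "2 * c < 1"
    using lt lt' assms(1) by (auto simp: c_def field_simps)
  have "1 - 2 * c = (1 - 2 * a * real (Suc n)) / (1 - 2 * a * real n)"
    using lt' by (simp add: c_def field_simps)
  then have "d = c / (1 - 2 * c)"
    using lt' by (simp add: c_def d_def)
  moreover have "c + 2 * c\<^sup>2 \<le> c / (1 - 2 * c)"
  proof -
    have "(c + 2 * c\<^sup>2) * (1 - 2 * c) = c - 4 * c ^ 3"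
      by (simp add: algebra_simps power2_eq_square power3_eq_cube)
    also have "\<dots> \<le> c"
      using c by simp
    finally show ?thesis
      using c by (simp add: pos_le_divide_eq)
  qed
  ultimately have cd: "c + 2 * c\<^sup>2 \<le> d" and "c \<le> d"
    using c by (auto intro: order_trans[rotated])
  have IH: "(\<Sum>\<sigma>\<in>spins n. exp (a * (t + ?S \<sigma>)\<^sup>2)) \<le> 2 ^ n * exp (c * (real n + t\<^sup>2))" for t
    unfolding c_def using Suc.prems lt' by (intro Suc.IH) auto
  have upd: "(\<Sum>i<n. \<tau> i * (\<sigma>(n := y)) i) = ?S \<sigma>" for \<sigma> y
    by (intro sum.cong) auto
  have "(\<Sum>\<sigma>\<in>spins (Suc n). exp (a * (s + (\<Sum>i<Suc n. \<tau> i * \<sigma> i))\<^sup>2))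
      = (\<Sum>\<sigma>\<in>spins n. exp (a * ((s - \<tau> n) + ?S \<sigma>)\<^sup>2)) + (\<Sum>\<sigma>\<in>spins n. exp (a * ((s + \<tau> n) + ?S \<sigma>)\<^sup>2))"
    by (simp add: sum_spins_Suc sum.distrib upd fun_upd_same algebra_simps del: fun_upd_apply)
  also have "\<dots> \<le> 2 ^ n * exp (c * (real n + (s - \<tau> n)\<^sup>2)) + 2 ^ n * exp (c * (real n + (s + \<tau> n)\<^sup>2))"
    by (intro add_mono IH)
  \<comment> \<open>The two values of the last spin differ only in the sign of the cross term of the
    square, so together they give a \<open>cosh\<close>.\<close>
  also have "\<dots> = 2 ^ Suc n * (exp (c * (real n + 1 + s\<^sup>2)) * cosh (2 * c * s * \<tau> n))"
  proof -
    have "(\<tau> n)\<^sup>2 = 1"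
      using Suc.prems(2)[of n] by (simp add: abs_square_eq_1)
    then have eqs: "(s - \<tau> n)\<^sup>2 = 1 + s\<^sup>2 - 2 * s * \<tau> n" "(s + \<tau> n)\<^sup>2 = 1 + s\<^sup>2 + 2 * s * \<tau> n"
      by (auto simp: power2_diff power2_sum)
    show ?thesis
      unfolding eqs by (simp add: cosh_def exp_add[symmetric] algebra_simps)
  qed
  also have "\<dots> \<le> 2 ^ Suc n * (exp (c * (real n + 1 + s\<^sup>2)) * exp ((2 * c * s * \<tau> n)\<^sup>2 / 2))"
    by (intro mult_left_mono cosh_le_exp_half_sq) auto
  \<comment> \<open>The bound on \<open>cosh\<close> adds \<open>2 * c\<^sup>2\<close> to the
    coefficient of \<open>s\<^sup>2\<close>; this is the increment that \<open>d\<close>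
    absorbs.\<close>
  also have "\<dots> = 2 ^ Suc n * exp (c * (real n + 1) + (c + 2 * c\<^sup>2) * s\<^sup>2)"
  proof -
    have "(\<tau> n)\<^sup>2 = 1"
      using Suc.prems(2)[of n] by (simp add: abs_square_eq_1)
    then show ?thesis
      by (simp add: exp_add[symmetric] power_mult_distrib algebra_simps)
  qed
  also have "\<dots> \<le> 2 ^ Suc n * exp (d * (real n + 1) + d * s\<^sup>2)"
    using cd \<open>c \<le> d\<close> by (simp add: add_mono mult_right_mono)
  also have "\<dots> = 2 ^ Suc n * exp (d * (real (Suc n) + s\<^sup>2))"
    by (simp add: algebra_simps)
  finally show ?case
    unfolding d_def .
qed

section \<open>Lipschitz dependence of the free energy on the matrix\<close>

lemma abs_ln_sum_exp_diff_le:
  fixes u v :: "'b \<Rightarrow> real"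
  assumes "finite S" "S \<noteq> {}" "0 < c" and d: "\<And>s. s \<in> S \<Longrightarrow> \<bar>u s - v s\<bar> \<le> d"
  shows "\<bar>ln (c * (\<Sum>s\<in>S. exp (u s))) - ln (c * (\<Sum>s\<in>S. exp (v s)))\<bar> \<le> d"
proof -
  \<comment> \<open>Raising every exponent by at most \<open>d\<close> multiplies the sum by at most
    \<open>exp d\<close>. The claim follows by applying this in both directions.\<close>
  have *: "ln (c * (\<Sum>s\<in>S. exp (u s))) \<le> d + ln (c * (\<Sum>s\<in>S. exp (v s)))"
    if "\<And>s. s \<in> S \<Longrightarrow> u s \<le> d + v s" for u v :: "'b \<Rightarrow> real"
  proof -
    have pos: "0 < c * (\<Sum>s\<in>S. exp (w s))" for w :: "'b \<Rightarrow> real"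
      using assms by (intro mult_pos_pos sum_pos) auto
    have "c * (\<Sum>s\<in>S. exp (u s)) \<le> c * (\<Sum>s\<in>S. exp d * exp (v s))"
      using assms that by (intro mult_left_mono sum_mono) (auto simp: exp_add[symmetric])
    also have "\<dots> = exp d * (c * (\<Sum>s\<in>S. exp (v s)))"
      by (simp add: sum_distrib_left mult_ac)
    finally have "ln (c * (\<Sum>s\<in>S. exp (u s))) \<le> ln (exp d * (c * (\<Sum>s\<in>S. exp (v s))))"
      using pos[of u] by (intro ln_mono) auto
    also have "\<dots> = d + ln (c * (\<Sum>s\<in>S. exp (v s)))"
      using pos[of v] by (subst ln_mult_pos) auto
    finally show ?thesis .
  qed
  have "u s \<le> d + v s" "v s \<le> d + u s" if "s \<in> S" for s
    using d[OF that] by (auto simp: abs_le_iff)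
  from *[of u v, OF this(1)] *[of v u, OF this(2)] show ?thesis
    by (simp add: abs_le_iff)
qed

text \<open>Spins have modulus 1, so the quadratic forms of \<open>A\<close> and \<open>B\<close>
  differ by at most the entrywise l1 distance, uniformly in the configuration; the log-sum-exp bound
  then applies.\<close>

lemma free_energy_lipschitz:
  assumes "0 \<le> \<beta>"
  shows "\<bar>free_energy N \<beta> A - free_energy N \<beta> B\<bar> \<le> \<beta> / real N * (\<Sum>i<N. \<Sum>j<N. \<bar>A i j - B i j\<bar>)"
proof -
  let ?d = "\<Sum>i<N. \<Sum>j<N. \<bar>A i j - B i j\<bar>"
  have "\<bar>\<beta> * quad_form N A \<sigma> - \<beta> * quad_form N B \<sigma>\<bar> \<le> \<beta> * ?d" if "\<sigma> \<in> spins N" for \<sigma>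
  proof -
    have "\<bar>quad_form N A \<sigma> - quad_form N B \<sigma>\<bar> = \<bar>\<Sum>i<N. \<Sum>j<N. \<sigma> i * (A i j - B i j) * \<sigma> j\<bar>"
      by (simp add: quad_form_def sum_subtractf[symmetric] algebra_simps)
    also have "\<dots> \<le> (\<Sum>i<N. \<Sum>j<N. \<bar>\<sigma> i * (A i j - B i j) * \<sigma> j\<bar>)"
      by (rule order_trans[OF sum_abs]) (intro sum_mono sum_abs)
    also have "\<dots> = ?d"
      using that by (intro sum.cong refl) (simp add: abs_mult abs_spins)
    finally show ?thesis
      using assms by (simp add: right_diff_distrib[symmetric] abs_mult mult_left_mono)
  qed
  then have "\<bar>ln (1 / 2 ^ N * (\<Sum>\<sigma>\<in>spins N. exp (\<beta> * quad_form N A \<sigma>)))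
      - ln (1 / 2 ^ N * (\<Sum>\<sigma>\<in>spins N. exp (\<beta> * quad_form N B \<sigma>)))\<bar> \<le> \<beta> * ?d"
    by (intro abs_ln_sum_exp_diff_le) (auto simp: spins_nonempty)
  then have "1 / real N * \<bar>ln (1 / 2 ^ N * (\<Sum>\<sigma>\<in>spins N. exp (\<beta> * quad_form N A \<sigma>)))
      - ln (1 / 2 ^ N * (\<Sum>\<sigma>\<in>spins N. exp (\<beta> * quad_form N B \<sigma>)))\<bar> \<le> 1 / real N * (\<beta> * ?d)"
    by (intro mult_left_mono) auto
  then show ?thesis
    unfolding free_energy_def by (simp add: diff_divide_distrib[symmetric] abs_mult)
qed

text \<open>Used to rewrite sums over all matrix entries in terms of the independent ones, those on
  and above the diagonal. The induction adds the last row and column.\<close>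

lemma sum_symmetric:
  fixes g :: "nat \<Rightarrow> nat \<Rightarrow> real"
  assumes "\<And>i j. i < N \<Longrightarrow> j < N \<Longrightarrow> g i j = g j i"
  shows "(\<Sum>i<N. \<Sum>j<N. g i j) = (\<Sum>(i, j)\<in>{(i, j). i \<le> j \<and> j < N}. (if i = j then 1 else 2) * g i j)"
  using assms
proof (induction N)
  case 0
  then show ?case by simp
next
  case (Suc N)
  let ?I = "{(i, j). i \<le> j \<and> j < N}" and ?J = "(\<lambda>i. (i, N)) ` {..N}"
  let ?h = "\<lambda>(i, j). (if i = j then 1 else 2) * g i j"
  have fin: "finite ?I"
    by (rule finite_subset[of _ "{..<N} \<times> {..<N}"]) auto
  have "{(i, j). i \<le> j \<and> j < Suc N} = ?I \<union> ?J"
    by auto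
  then have "sum ?h {(i, j). i \<le> j \<and> j < Suc N} = sum ?h ?I + sum ?h ?J"
    using fin by (simp only:) (intro sum.union_disjoint, auto)
  also have "sum ?h ?J = (\<Sum>i\<le>N. (if i = N then 1 else 2) * g i N)"
    by (subst sum.reindex) (auto simp: inj_on_def)
  also have "\<dots> = (\<Sum>i<N. 2 * g i N) + g N N"
    unfolding lessThan_Suc_atMost[symmetric] by simp
  also have "sum ?h ?I = (\<Sum>i<N. \<Sum>j<N. g i j)"
    using Suc by simp
  also have "(\<Sum>i<N. 2 * g i N) = (\<Sum>i<N. g i N) + (\<Sum>i<N. g N i)"
    unfolding sum.distrib[symmetric] using Suc.prems by (intro sum.cong) auto
  finally show ?case
    by (simp add: sum.distrib)
qed

section \<open>Moments of the partition sum\<close>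

text \<open>Completing the square: tilting the density by \<open>exp (t * x)\<close> gives a
  constant times the normal density with mean \<open>s\<^sup>2 * t\<close>, which has total mass
  1.\<close>

lemma normal_exp_moment:
  fixes X :: "'a \<Rightarrow> real"
  assumes X: "distributed M lborel X (\<lambda>x. ennreal (normal_density 0 s x))" and "0 < s"
  shows "integrable M (\<lambda>\<omega>. exp (t * X \<omega>))"
    and "(\<integral>\<omega>. exp (t * X \<omega>) \<partial>M) = exp (t\<^sup>2 * s\<^sup>2 / 2)"
proof -
  have eq: "normal_density 0 s x * exp (t * x) = exp (t\<^sup>2 * s\<^sup>2 / 2) * normal_density (s\<^sup>2 * t) s x" for x
  proof -
    have "- (x - 0)\<^sup>2 / (2 * s\<^sup>2) + t * x = t\<^sup>2 * s\<^sup>2 / 2 + - (x - s\<^sup>2 * t)\<^sup>2 / (2 * s\<^sup>2)"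
      using \<open>0 < s\<close> by (simp add: field_simps power2_eq_square)
    then show ?thesis
      unfolding normal_density_def by (simp only: mult.assoc mult.left_commute exp_add[symmetric])
  qed
  show "integrable M (\<lambda>\<omega>. exp (t * X \<omega>))"
    using \<open>0 < s\<close> by (subst distributed_integrable[OF X, symmetric]) (auto simp: eq)
  show "(\<integral>\<omega>. exp (t * X \<omega>) \<partial>M) = exp (t\<^sup>2 * s\<^sup>2 / 2)"
    using \<open>0 < s\<close> by (subst distributed_integral[OF X, symmetric]) (auto simp: eq)
qed

lemma GOE_D:
  assumes "GOE N M W"
  shows "prob_space M"
    and "\<And>\<omega> i j. \<omega> \<in> space M \<Longrightarrow> i < N \<Longrightarrow> j < N \<Longrightarrow> W i j \<omega> = W j i \<omega>"
    and "prob_space.indep_vars M (\<lambda>_. borel) (\<lambda>(i, j). W i j) {(i, j). i \<le> j \<and> j < N}"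
    and "\<And>i j. i \<le> j \<Longrightarrow> j < N \<Longrightarrow>
      distributed M lborel (W i j) (\<lambda>x. ennreal (normal_density 0 (if i = j then sqrt 2 else 1) x))"
  using assms unfolding GOE_def by blast+

lemma GOE_measurable:
  assumes goe: "GOE N M W" and "i < N" "j < N"
  shows "W i j \<in> borel_measurable M"
proof -
  have *: "W i j \<in> borel_measurable M" if "i \<le> j" "j < N" for i j
    using distributed_measurable[OF GOE_D(4)[OF goe that]] by simp
  have "W j i \<in> borel_measurable M \<longleftrightarrow> W i j \<in> borel_measurable M"
    using GOE_D(2)[OF goe] assms by (intro measurable_cong) auto
  then show ?thesis
    using *[of i j] *[of j i] assms by (cases "i \<le> j") auto
qed

lemma GOE_entry:
  assumes goe: "GOE N M W" and ij: "i \<le> j" "j < N"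
  shows "integrable M (\<lambda>\<omega>. (W i j \<omega>)\<^sup>2)"
    and "prob_space.variance M (W i j) = (if i = j then 2 else 1)"
proof -
  interpret prob_space M by (rule GOE_D(1)[OF goe])
  let ?s = "if i = j then sqrt 2 else 1"
  note D = GOE_D(4)[OF goe ij]
  have "0 < ?s"
    by simp
  from integrable_normal_moment[OF this, of 0 2] show "integrable M (\<lambda>\<omega>. (W i j \<omega>)\<^sup>2)"
    by (subst distributed_integrable[OF D, symmetric]) auto
  show "variance (W i j) = (if i = j then 2 else 1)"
    using normal_distributed_variance[OF \<open>0 < ?s\<close> D] by (simp split: if_splits)
qed

text \<open>By independence the moment factors over the upper triangle. A diagonal entry has
  coefficient \<open>A i i\<close> and variance 2, giving exponent \<open>(A i i)\<^sup>2\<close>;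
  an off-diagonal one has coefficient \<open>2 * A i j\<close> and variance 1, giving
  \<open>2 * (A i j)\<^sup>2\<close>. With this normalization the exponents add up to the squared
  Frobenius norm of \<open>A\<close>.\<close>

lemma GOE_exp_moment:
  assumes goe: "GOE N M W" and sym: "\<And>i j. A i j = A j i"
  shows "integrable M (\<lambda>\<omega>. exp (\<Sum>i<N. \<Sum>j<N. A i j * W i j \<omega>))"
    and "(\<integral>\<omega>. exp (\<Sum>i<N. \<Sum>j<N. A i j * W i j \<omega>) \<partial>M) = exp (\<Sum>i<N. \<Sum>j<N. (A i j)\<^sup>2)"
proof -
  interpret prob_space M by (rule GOE_D(1)[OF goe])
  let ?I = "{(i, j). i \<le> j \<and> j < N}"
  let ?w = "\<lambda>(i, j). (if i = j then 1 else 2) * A i j"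
  let ?Y = "\<lambda>p \<omega>. exp (?w p * (case p of (i, j) \<Rightarrow> W i j) \<omega>)"
  have fin: "finite ?I"
    by (rule finite_subset[of _ "{..<N} \<times> {..<N}"]) auto
  have indep: "indep_vars (\<lambda>_. borel) ?Y ?I"
    by (rule indep_vars_compose2[OF GOE_D(3)[OF goe]]) auto
  have exp_eq: "exp (\<Sum>i<N. \<Sum>j<N. A i j * W i j \<omega>) = (\<Prod>p\<in>?I. ?Y p \<omega>)" if "\<omega> \<in> space M" for \<omega>
  proof -
    have "(\<Sum>i<N. \<Sum>j<N. A i j * W i j \<omega>) = (\<Sum>(i, j)\<in>?I. (if i = j then 1 else 2) * (A i j * W i j \<omega>))"
      using GOE_D(2)[OF goe that] sym by (intro sum_symmetric) auto
    then show ?thesis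
      using fin by (simp add: exp_sum[symmetric] case_prod_beta' mult.assoc)
  qed
  have Y: "integrable M (?Y p)" "expectation (?Y p) = exp (case p of (i, j) \<Rightarrow> (if i = j then 1 else 2) * (A i j)\<^sup>2)"
    if pI: "p \<in> ?I" for p
  proof -
    obtain i j where p: "p = (i, j)" "i \<le> j" "j < N"
      using pI by auto
    let ?s = "if i = j then sqrt 2 else (1 :: real)"
    have "0 < ?s"
      by simp
    note m = normal_exp_moment[OF GOE_D(4)[OF goe p(2,3)] this, of "?w (i, j)"]
    show "integrable M (?Y p)"
      using m(1) by (simp add: p)
    show "expectation (?Y p) = exp (case p of (i, j) \<Rightarrow> (if i = j then 1 else 2) * (A i j)\<^sup>2)"
      using m(2) by (simp add: p power_mult_distrib split: if_splits)
  qed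
  show "integrable M (\<lambda>\<omega>. exp (\<Sum>i<N. \<Sum>j<N. A i j * W i j \<omega>))"
    using indep_vars_integrable[OF fin indep Y(1)]
    by (subst Bochner_Integration.integrable_cong[OF refl exp_eq])
  have "(\<integral>\<omega>. exp (\<Sum>i<N. \<Sum>j<N. A i j * W i j \<omega>) \<partial>M) = (\<integral>\<omega>. (\<Prod>p\<in>?I. ?Y p \<omega>) \<partial>M)"
    by (rule Bochner_Integration.integral_cong[OF refl exp_eq])
  also have "\<dots> = (\<Prod>p\<in>?I. expectation (?Y p))"
    by (rule indep_vars_lebesgue_integral[OF fin indep Y(1)])
  also have "\<dots> = (\<Prod>p\<in>?I. exp (case p of (i, j) \<Rightarrow> (if i = j then 1 else 2) * (A i j)\<^sup>2))"
    by (rule prod.cong[OF refl Y(2)])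
  also have "\<dots> = exp (\<Sum>(i, j)\<in>?I. (if i = j then 1 else 2) * (A i j)\<^sup>2)"
    using fin by (simp add: exp_sum)
  also have "(\<Sum>(i, j)\<in>?I. (if i = j then 1 else 2) * (A i j)\<^sup>2) = (\<Sum>i<N. \<Sum>j<N. (A i j)\<^sup>2)"
    using sym by (intro sum_symmetric[symmetric]) metis
  finally show "(\<integral>\<omega>. exp (\<Sum>i<N. \<Sum>j<N. A i j * W i j \<omega>) \<partial>M) = exp (\<Sum>i<N. \<Sum>j<N. (A i j)\<^sup>2)" .
qed

definition partition_sum :: "nat \<Rightarrow> real \<Rightarrow> (nat \<Rightarrow> nat \<Rightarrow> real) \<Rightarrow> real" where
  "partition_sum N \<beta> A = 1 / 2 ^ N * (\<Sum>\<sigma>\<in>spins N. exp (\<beta> * quad_form N A \<sigma>))"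

lemma free_energy_eq: "free_energy N \<beta> A = 1 / real N * ln (partition_sum N \<beta> A)"
  by (simp add: free_energy_def partition_sum_def)

lemma partition_sum_pos: "0 < partition_sum N \<beta> A"
  unfolding partition_sum_def by (intro mult_pos_pos sum_pos) (auto simp: spins_nonempty)

text \<open>This exhibits the exponent as a linear form in the entries with symmetric coefficients,
  the form to which \<open>GOE_exp_moment\<close> applies.\<close>

lemma quad_form_normalized:
  "\<beta> * quad_form N (normalized N A) \<sigma> = (\<Sum>i<N. \<Sum>j<N. \<beta> / sqrt (real N) * (\<sigma> i * \<sigma> j) * A i j)"
  by (simp add: quad_form_def normalized_def sum_distrib_left mult_ac)

lemma partition_sum_measurable:
  assumes "GOE N M W"
  shows "(\<lambda>\<omega>. partition_sum N \<beta> (normalized N (\<lambda>i j. W i j \<omega>))) \<in> borel_measurable M"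
proof -
  have [measurable]: "W i j \<in> borel_measurable M" if "i \<in> {..<N}" "j \<in> {..<N}" for i j
    using GOE_measurable[OF assms] that by simp
  show ?thesis
    unfolding partition_sum_def quad_form_normalized by measurable
qed

text \<open>Every configuration contributes equally: its coefficient matrix has
  \<open>N\<^sup>2\<close> entries, each with square \<open>\<beta>\<^sup>2 / N\<close>.\<close>

lemma partition_sum_expectation:
  fixes \<beta> :: real
  assumes goe: "GOE N M W" and "0 < N"
  defines "Z \<equiv> \<lambda>\<omega>. partition_sum N \<beta> (normalized N (\<lambda>i j. W i j \<omega>))"
  shows "integrable M Z" and "integral\<^sup>L M Z = exp (\<beta>\<^sup>2 * real N)"
proof -
  let ?X = "\<lambda>\<sigma> \<omega>. exp (\<Sum>i<N. \<Sum>j<N. \<beta> / sqrt (real N) * (\<sigma> i * \<sigma> j) * W i j \<omega>)"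
  have Z: "Z = (\<lambda>\<omega>. 1 / 2 ^ N * (\<Sum>\<sigma>\<in>spins N. ?X \<sigma> \<omega>))"
    unfolding Z_def partition_sum_def quad_form_normalized ..
  note X = GOE_exp_moment[OF goe, of "\<lambda>i j. \<beta> / sqrt (real N) * (\<sigma> i * \<sigma> j)" for \<sigma>]
  have X1: "integrable M (?X \<sigma>)" for \<sigma>
    by (rule X(1)) (simp add: mult.commute)
  have X2: "integral\<^sup>L M (?X \<sigma>) = exp (\<beta>\<^sup>2 * real N)" if "\<sigma> \<in> spins N" for \<sigma>
  proof -
    have "integral\<^sup>L M (?X \<sigma>) = exp (\<Sum>i<N. \<Sum>j<N. (\<beta> / sqrt (real N) * (\<sigma> i * \<sigma> j))\<^sup>2)"
      by (rule X(2)) (simp add: mult.commute)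
    also have "(\<Sum>i<N. \<Sum>j<N. (\<beta> / sqrt (real N) * (\<sigma> i * \<sigma> j))\<^sup>2) = (\<Sum>i<N. \<Sum>j<N. \<beta>\<^sup>2 / real N)"
      using spins_sq[OF that] by (intro sum.cong refl) (simp add: power_mult_distrib power_divide)
    finally show ?thesis
      using \<open>0 < N\<close> by (simp add: mult.commute)
  qed
  show "integrable M Z"
    unfolding Z by (intro integrable_mult_right Bochner_Integration.integrable_sum X1)
  show "integral\<^sup>L M Z = exp (\<beta>\<^sup>2 * real N)"
    unfolding Z using X1 X2 by (simp add: card_spins)
qed

text \<open>The square of \<open>Z\<close> is a sum over pairs of configurations, and the Gaussian
  moment of a pair depends only on its overlap. For fixed \<open>\<tau>\<close> the sum over
  \<open>\<sigma>\<close> is bounded by \<open>sum_spins_exp_square_le\<close>.\<close>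

lemma partition_sum_second_moment:
  fixes \<beta> :: real
  assumes goe: "GOE N M W" and "0 < N" and \<beta>: "4 * \<beta>\<^sup>2 < 1"
  defines "Z \<equiv> \<lambda>\<omega>. partition_sum N \<beta> (normalized N (\<lambda>i j. W i j \<omega>))"
  shows "integrable M (\<lambda>\<omega>. (Z \<omega>)\<^sup>2)"
    and "(\<integral>\<omega>. (Z \<omega>)\<^sup>2 \<partial>M) \<le> exp (2 * \<beta>\<^sup>2 / (1 - 4 * \<beta>\<^sup>2)) * (exp (\<beta>\<^sup>2 * real N))\<^sup>2"
proof -
  let ?A = "\<lambda>\<sigma> \<tau> i j. \<beta> / sqrt (real N) * (\<sigma> i * \<sigma> j + \<tau> i * \<tau> j)"
  let ?X = "\<lambda>\<tau> \<sigma> \<omega>. exp (\<Sum>i<N. \<Sum>j<N. ?A \<sigma> \<tau> i j * W i j \<omega>)"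
  let ?C = "exp (2 * \<beta>\<^sup>2 / (1 - 4 * \<beta>\<^sup>2))"
  have Z2: "(\<lambda>\<omega>. (Z \<omega>)\<^sup>2) = (\<lambda>\<omega>. 1 / 4 ^ N * (\<Sum>\<tau>\<in>spins N. \<Sum>\<sigma>\<in>spins N. ?X \<tau> \<sigma> \<omega>))"
  proof
    fix \<omega>
    have "(4 :: real) ^ N = 2 ^ N * 2 ^ N"
      by (simp add: power_mult_distrib[symmetric])
    then show "(Z \<omega>)\<^sup>2 = 1 / 4 ^ N * (\<Sum>\<tau>\<in>spins N. \<Sum>\<sigma>\<in>spins N. ?X \<tau> \<sigma> \<omega>)"
      unfolding Z_def partition_sum_def quad_form_normalized power2_eq_square
      by (simp add: sum_product exp_add[symmetric] sum.distrib[symmetric] distrib_left distrib_right add.commute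
          add_divide_distrib)
  qed
  note X = GOE_exp_moment[OF goe, of "?A \<sigma> \<tau>" for \<sigma> \<tau>]
  have X1: "integrable M (?X \<tau> \<sigma>)" for \<tau> \<sigma>
    by (rule X(1)) (simp add: mult.commute)
  have X2: "integral\<^sup>L M (?X \<tau> \<sigma>)
      = exp (2 * \<beta>\<^sup>2 * real N) * exp (2 * \<beta>\<^sup>2 / real N * (0 + (\<Sum>i<N. \<tau> i * \<sigma> i))\<^sup>2)"
    if "\<tau> \<in> spins N" "\<sigma> \<in> spins N" for \<tau> \<sigma>
  proof -
    have "integral\<^sup>L M (?X \<tau> \<sigma>) = exp (\<Sum>i<N. \<Sum>j<N. (?A \<sigma> \<tau> i j)\<^sup>2)"
      by (rule X(2)) (simp add: mult.commute)
    \<comment> \<open>All spins square to 1, so only the cross term varies; summed over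
      \<open>i\<close> and \<open>j\<close> it factors into the squared overlap.\<close>
    also have "(\<Sum>i<N. \<Sum>j<N. (?A \<sigma> \<tau> i j)\<^sup>2)
        = (\<Sum>i<N. \<Sum>j<N. 2 * \<beta>\<^sup>2 / real N + 2 * \<beta>\<^sup>2 / real N * ((\<tau> i * \<sigma> i) * (\<tau> j * \<sigma> j)))"
      using spins_sq[OF that(1)] spins_sq[OF that(2)]
      by (intro sum.cong refl) (simp add: power_mult_distrib power_divide power2_sum algebra_simps, simp add: power2_eq_square)
    also have "\<dots> = 2 * \<beta>\<^sup>2 * real N + 2 * \<beta>\<^sup>2 / real N * (\<Sum>i<N. \<tau> i * \<sigma> i)\<^sup>2"
      using \<open>0 < N\<close> by (simp add: sum.distrib power2_eq_square sum_product sum_distrib_left sum_divide_distrib mult_ac)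
    finally show ?thesis
      by (simp add: exp_add)
  qed
  show "integrable M (\<lambda>\<omega>. (Z \<omega>)\<^sup>2)"
    unfolding Z2 by (intro integrable_mult_right Bochner_Integration.integrable_sum X1)
  have "(\<integral>\<omega>. (Z \<omega>)\<^sup>2 \<partial>M) = 1 / 4 ^ N * (\<Sum>\<tau>\<in>spins N. \<Sum>\<sigma>\<in>spins N. integral\<^sup>L M (?X \<tau> \<sigma>))"
    unfolding Z2 using X1 by simp
  also have "\<dots> \<le> 1 / 4 ^ N * (\<Sum>\<tau>\<in>spins N. exp (2 * \<beta>\<^sup>2 * real N) * (2 ^ N * ?C))"
  proof (intro mult_left_mono sum_mono)
    fix \<tau> assume \<tau>: "\<tau> \<in> spins N"
    have "(\<Sum>\<sigma>\<in>spins N. integral\<^sup>L M (?X \<tau> \<sigma>)) = exp (2 * \<beta>\<^sup>2 * real N) *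
        (\<Sum>\<sigma>\<in>spins N. exp (2 * \<beta>\<^sup>2 / real N * (0 + (\<Sum>i<N. \<tau> i * \<sigma> i))\<^sup>2))"
      using X2[OF \<tau>] by (simp add: sum_distrib_left)
    \<comment> \<open>Here \<open>a\<close> is \<open>2 * \<beta>\<^sup>2 / N\<close>, so
      \<open>2 * a * N\<close> equals \<open>4 * \<beta>\<^sup>2\<close>: the dimension cancels,
      both in the smallness condition and in the constant \<open>?C\<close>.\<close>
    also have "\<dots> \<le> exp (2 * \<beta>\<^sup>2 * real N) *
        (2 ^ N * exp (2 * \<beta>\<^sup>2 / real N / (1 - 2 * (2 * \<beta>\<^sup>2 / real N) * real N) * (real N + 0\<^sup>2)))"
      using \<beta> \<open>0 < N\<close> abs_spins[OF \<tau>] by (intro mult_left_mono sum_spins_exp_square_le) auto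
    finally show "(\<Sum>\<sigma>\<in>spins N. integral\<^sup>L M (?X \<tau> \<sigma>)) \<le> exp (2 * \<beta>\<^sup>2 * real N) * (2 ^ N * ?C)"
      using \<open>0 < N\<close> by simp
  qed auto
  also have "\<dots> = ?C * (exp (\<beta>\<^sup>2 * real N))\<^sup>2"
  proof -
    have "(4 :: real) ^ N = 2 ^ N * 2 ^ N"
      by (simp add: power_mult_distrib[symmetric])
    then show ?thesis
      by (simp add: card_spins exp_double[symmetric] mult_ac)
  qed
  finally show "(\<integral>\<omega>. (Z \<omega>)\<^sup>2 \<partial>M) \<le> ?C * (exp (\<beta>\<^sup>2 * real N))\<^sup>2" .
qed

text \<open>The Paley-Zygmund inequality at level 1/2. The part of \<open>Z\<close> below half its
  mean contributes at most half the mean, so the rest must come from the event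
  \<open>B\<close>.\<close>

lemma (in prob_space) prob_half_expectation_ge:
  fixes Z :: "'a \<Rightarrow> real"
  assumes Z: "integrable M Z" and Z2: "integrable M (\<lambda>\<omega>. (Z \<omega>)\<^sup>2)"
    and "0 < expectation Z" and C: "expectation (\<lambda>\<omega>. (Z \<omega>)\<^sup>2) \<le> C * (expectation Z)\<^sup>2"
  shows "1 / (4 * C) \<le> prob {\<omega> \<in> space M. expectation Z / 2 \<le> Z \<omega>}"
proof -
  define m where "m = expectation Z"
  define B where "B = {\<omega> \<in> space M. m / 2 \<le> Z \<omega>}"
  have [measurable]: "Z \<in> borel_measurable M"
    using Z by auto
  have B [measurable]: "B \<in> sets M"
    unfolding B_def by measurable
  have indB: "integrable M (indicator B :: 'a \<Rightarrow> real)"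
    by (intro integrable_real_indicator) (auto simp: less_top[symmetric])
  have pos: "0 < m"
    using assms(3) by (simp add: m_def)
  have "(expectation Z)\<^sup>2 \<le> expectation (\<lambda>\<omega>. (Z \<omega>)\<^sup>2)"
    using variance_eq[OF Z Z2] variance_positive[of Z] by simp
  with C have "1 * m\<^sup>2 \<le> C * m\<^sup>2"
    by (simp add: m_def)
  then have "1 \<le> C"
    using pos by simp
  \<comment> \<open>On \<open>B\<close> this is the arithmetic-geometric mean inequality in place of
    Cauchy-Schwarz. The weight \<open>4 * C * m\<close> makes the second moment term contribute at
    most \<open>m / 4\<close>, leaving \<open>m / 4\<close> for \<open>B\<close>.\<close>
  have "Z \<omega> \<le> m / 2 + ((Z \<omega>)\<^sup>2 / (4 * C * m) + C * m * indicator B \<omega>)" if "\<omega> \<in> space M" for \<omega>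
  proof (cases "\<omega> \<in> B")
    case True
    have "Z \<omega> \<le> (Z \<omega>)\<^sup>2 / (4 * C * m) + C * m"
    proof -
      have "0 \<le> (Z \<omega> - 2 * C * m)\<^sup>2 / (4 * C * m)"
        using pos \<open>1 \<le> C\<close> by simp
      also have "\<dots> = (Z \<omega>)\<^sup>2 / (4 * C * m) + C * m - Z \<omega>"
        using pos \<open>1 \<le> C\<close> by (simp add: power2_eq_square field_simps)
      finally show ?thesis by simp
    qed
    with True show ?thesis
      using pos by simp
  next
    case False
    moreover have "0 \<le> (Z \<omega>)\<^sup>2 / (4 * C * m)"
      using pos \<open>1 \<le> C\<close> by simp
    ultimately show ?thesis
      using that by (simp add: B_def)
  qed
  then have "expectation Z \<le> expectation (\<lambda>\<omega>. m / 2 + ((Z \<omega>)\<^sup>2 / (4 * C * m) + C * m * indicator B \<omega>))"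
    using Z Z2 indB by (intro integral_mono) auto
  also have "\<dots> = m / 2 + (expectation (\<lambda>\<omega>. (Z \<omega>)\<^sup>2) / (4 * C * m) + C * m * prob B)"
    using Z2 indB by (simp add: prob_space sets.Int_space_eq2)
  also have "expectation (\<lambda>\<omega>. (Z \<omega>)\<^sup>2) / (4 * C * m) \<le> C * m\<^sup>2 / (4 * C * m)"
    using C pos \<open>1 \<le> C\<close> unfolding m_def[symmetric] by (intro divide_right_mono) auto
  also have "C * m\<^sup>2 / (4 * C * m) = m / 4"
    using pos \<open>1 \<le> C\<close> by (simp add: power2_eq_square)
  finally have "m * (1 / 4) \<le> m * (C * prob B)"
    by (simp add: m_def[symmetric] algebra_simps)
  then have "1 / 4 \<le> C * prob B"
    using pos by (simp only: mult_le_cancel_left_pos)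
  then show ?thesis
    using \<open>1 \<le> C\<close> by (simp add: B_def m_def field_simps)
qed

section \<open>Concentration of the free energy\<close>

lemma free_energy_measurable:
  assumes "GOE N M W"
  shows "(\<lambda>\<omega>. free_energy N \<beta> (normalized N (\<lambda>i j. W i j \<omega>))) \<in> borel_measurable M"
  unfolding free_energy_eq using partition_sum_measurable[OF assms] by measurable

text \<open>There are at most \<open>N\<^sup>2\<close> independent entries of variance at most 2,
  and \<open>L\<^sup>2 * 2 * N\<^sup>2\<close> is the stated bound.\<close>

lemma free_energy_variance:
  fixes \<beta> :: real
  assumes goe: "GOE N M W" and "0 < N" and "0 \<le> \<beta>"
  defines "F \<equiv> \<lambda>\<omega>. free_energy N \<beta> (normalized N (\<lambda>i j. W i j \<omega>))"
  shows "integrable M (\<lambda>\<omega>. (F \<omega>)\<^sup>2)" and "prob_space.variance M F \<le> 8 * \<beta>\<^sup>2 / real N"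
proof -
  interpret prob_space M by (rule GOE_D(1)[OF goe])
  let ?I = "{(i, j). i \<le> j \<and> j < N}"
  let ?X = "\<lambda>(i, j). W i j"
  \<comment> \<open>Rebuilds a full symmetric matrix from coordinates on and above the diagonal, so
    that \<open>f\<close> depends on the independent entries alone.\<close>
  let ?sym = "\<lambda>x i j. x (min i j, max i j)"
  define f :: "(nat \<times> nat \<Rightarrow> real) \<Rightarrow> real" where "f x = free_energy N \<beta> (normalized N (?sym x))" for x
  \<comment> \<open>The factor \<open>\<beta> / N\<close> is the Lipschitz constant of the free
    energy, \<open>1 / sqrt N\<close> comes from the normalization, and 2 from each off-diagonal
    entry occurring twice.\<close>
  define L where "L = 2 * \<beta> / (real N * sqrt (real N))"
  have fin: "finite ?I"
    by (rule finite_subset[of _ "{..<N} \<times> {..<N}"]) auto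
  have f [measurable]: "f \<in> borel_measurable (PiM ?I (\<lambda>_. borel))"
  proof -
    have [measurable]: "(\<lambda>x. ?sym x i j) \<in> borel_measurable (PiM ?I (\<lambda>_. borel))"
      if "i \<in> {..<N}" "j \<in> {..<N}" for i j
      using that by (intro measurable_component_singleton) (auto simp: min_def max_def)
    show ?thesis
      unfolding f_def[abs_def] free_energy_def quad_form_normalized by measurable
  qed
  have lip: "\<bar>f x - f y\<bar> \<le> L * (\<Sum>p\<in>?I. \<bar>x p - y p\<bar>)" for x y
  proof -
    have "\<bar>f x - f y\<bar> \<le> \<beta> / real N * (\<Sum>i<N. \<Sum>j<N. \<bar>normalized N (?sym x) i j - normalized N (?sym y) i j\<bar>)"
      unfolding f_def using \<open>0 \<le> \<beta>\<close> by (rule free_energy_lipschitz)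
    also have "(\<Sum>i<N. \<Sum>j<N. \<bar>normalized N (?sym x) i j - normalized N (?sym y) i j\<bar>)
        = (\<Sum>i<N. \<Sum>j<N. \<bar>?sym x i j - ?sym y i j\<bar>) / sqrt (real N)"
      by (simp add: normalized_def diff_divide_distrib[symmetric] sum_divide_distrib)
    also have "(\<Sum>i<N. \<Sum>j<N. \<bar>?sym x i j - ?sym y i j\<bar>)
        = (\<Sum>(i, j)\<in>?I. (if i = j then 1 else 2) * \<bar>?sym x i j - ?sym y i j\<bar>)"
      by (rule sum_symmetric) (simp add: min.commute max.commute)
    also have "\<beta> / real N * (\<dots> / sqrt (real N)) \<le> \<beta> / real N * ((\<Sum>p\<in>?I. 2 * \<bar>x p - y p\<bar>) / sqrt (real N))"
      using \<open>0 \<le> \<beta>\<close> by (intro mult_left_mono divide_right_mono sum_mono) (auto simp: min_def max_def)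
    also have "\<dots> = L * (\<Sum>p\<in>?I. \<bar>x p - y p\<bar>)"
      by (simp add: L_def sum_distrib_left[symmetric])
    finally show ?thesis .
  qed
  have F: "F \<omega> = f (\<lambda>p\<in>?I. ?X p \<omega>)" if "\<omega> \<in> space M" for \<omega>
  proof -
    have "?sym (\<lambda>p\<in>?I. ?X p \<omega>) i j = W i j \<omega>" if "i < N" "j < N" for i j
      using that GOE_D(2)[OF goe \<open>\<omega> \<in> space M\<close>, of i j] by (auto simp: min_def max_def)
    then show ?thesis
      unfolding F_def f_def free_energy_def quad_form_normalized by simp
  qed
  have sq: "integrable M (\<lambda>\<omega>. (?X p \<omega>)\<^sup>2)" and var: "variance (?X p) \<le> 2" if "p \<in> ?I" for p
    using that GOE_entry[OF goe, of "fst p" "snd p"] by (auto simp: case_prod_beta')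
  note ES = Efron_Stein[OF fin GOE_D(3)[OF goe] sq f lip F]
  show "integrable M (\<lambda>\<omega>. (F \<omega>)\<^sup>2)"
    by (rule ES(1))
  have "card ?I \<le> card ({..<N} \<times> {..<N})"
    by (intro card_mono) auto
  then have card: "real (card ?I) \<le> (real N)\<^sup>2"
    by (simp add: power2_eq_square flip: of_nat_mult)
  have "variance F \<le> L\<^sup>2 * (\<Sum>p\<in>?I. variance (?X p))"
    by (rule ES(2))
  also have "\<dots> \<le> L\<^sup>2 * (\<Sum>p\<in>?I. 2)"
    by (intro mult_left_mono sum_mono var) auto
  also have "\<dots> \<le> L\<^sup>2 * (2 * (real N)\<^sup>2)"
    using card by (intro mult_left_mono) auto
  also have "\<dots> = 8 * \<beta>\<^sup>2 / real N"
    using \<open>0 < N\<close> by (simp add: L_def power_divide power_mult_distrib field_simps)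
  finally show "variance F \<le> 8 * \<beta>\<^sup>2 / real N" .
qed

text \<open>Hypothesis \<open>N2\<close> makes the Chebyshev bound smaller than the Paley-Zygmund
  probability. Hence some outcome has both a large \<open>Z\<close> and an \<open>F\<close> close to
  its mean, which bounds the mean from below.\<close>

lemma free_energy_deviation:
  fixes \<beta> \<epsilon> :: real
  assumes goe: "GOE N M W" and "0 < N" and "0 \<le> \<beta>" and \<beta>: "4 * \<beta>\<^sup>2 < 1" and "0 < \<epsilon>"
    and N1: "ln 2 / real N \<le> \<epsilon>"
    and N2: "8 * \<beta>\<^sup>2 / real N / \<epsilon>\<^sup>2 < 1 / (4 * exp (2 * \<beta>\<^sup>2 / (1 - 4 * \<beta>\<^sup>2)))"
  defines "F \<equiv> \<lambda>\<omega>. free_energy N \<beta> (normalized N (\<lambda>i j. W i j \<omega>))"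
  shows "measure M {\<omega> \<in> space M. \<bar>F \<omega> - \<beta>\<^sup>2\<bar> > 3 * \<epsilon>}
    \<le> 8 * \<beta>\<^sup>2 / real N / \<epsilon>\<^sup>2 + exp (- \<epsilon> * real N)"
proof -
  interpret prob_space M by (rule GOE_D(1)[OF goe])
  define Z where "Z \<omega> = partition_sum N \<beta> (normalized N (\<lambda>i j. W i j \<omega>))" for \<omega>
  let ?C = "exp (2 * \<beta>\<^sup>2 / (1 - 4 * \<beta>\<^sup>2))"
  let ?m = "expectation F"
  have FZ: "F \<omega> = ln (Z \<omega>) / real N" for \<omega>
    by (simp add: F_def Z_def free_energy_eq)
  have Z_pos: "0 < Z \<omega>" for \<omega>
    unfolding Z_def by (rule partition_sum_pos)
  have F_m [measurable]: "F \<in> borel_measurable M"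
    unfolding F_def using goe by (rule free_energy_measurable)
  have Z_m [measurable]: "Z \<in> borel_measurable M"
    unfolding Z_def[abs_def] using goe by (rule partition_sum_measurable)
  have Z1: "integrable M Z" and EZ: "expectation Z = exp (\<beta>\<^sup>2 * real N)"
    unfolding Z_def[abs_def] using partition_sum_expectation[OF goe \<open>0 < N\<close>] by auto
  have Z2: "integrable M (\<lambda>\<omega>. (Z \<omega>)\<^sup>2)" and EZ2: "expectation (\<lambda>\<omega>. (Z \<omega>)\<^sup>2) \<le> ?C * (expectation Z)\<^sup>2"
    unfolding EZ unfolding Z_def using partition_sum_second_moment[OF goe \<open>0 < N\<close> \<beta>] by auto
  have F2: "integrable M (\<lambda>\<omega>. (F \<omega>)\<^sup>2)" and var: "variance F \<le> 8 * \<beta>\<^sup>2 / real N"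
    unfolding F_def using free_energy_variance[OF goe \<open>0 < N\<close> \<open>0 \<le> \<beta>\<close>] by auto
  let ?D = "{\<omega> \<in> space M. \<bar>F \<omega> - ?m\<bar> \<ge> \<epsilon>}" and ?H = "{\<omega> \<in> space M. expectation Z / 2 \<le> Z \<omega>}"
  let ?U = "{\<omega> \<in> space M. exp (\<epsilon> * real N) * exp (\<beta>\<^sup>2 * real N) \<le> Z \<omega>}"
  have D: "prob ?D \<le> 8 * \<beta>\<^sup>2 / real N / \<epsilon>\<^sup>2"
    using Chebyshev_inequality[OF F_m F2 \<open>0 < \<epsilon>\<close>] divide_right_mono[OF var, of "\<epsilon>\<^sup>2"] by simp
  have "1 / (4 * ?C) \<le> prob ?H"
    using EZ EZ2 by (intro prob_half_expectation_ge Z1 Z2) auto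
  then have "prob ?D < prob ?H"
    using D N2 by simp
  \<comment> \<open>The strict inequality of probabilities yields a single outcome in
    \<open>?H\<close> outside \<open>?D\<close>. Since the mean of \<open>F\<close> is a number, one
    such outcome suffices to bound it.\<close>
  then have "\<not> ?H \<subseteq> ?D"
    using finite_measure_mono[of ?H ?D] by (auto simp: not_le)
  then obtain \<omega> where "\<omega> \<in> ?H" "\<omega> \<notin> ?D"
    by blast
  then have \<omega>: "exp (\<beta>\<^sup>2 * real N) / 2 \<le> Z \<omega>" "\<bar>F \<omega> - ?m\<bar> < \<epsilon>"
    by (auto simp: EZ)
  have "\<beta>\<^sup>2 * real N - ln 2 = ln (exp (\<beta>\<^sup>2 * real N) / 2)"
    by (simp add: ln_div)
  also have "\<dots> \<le> ln (Z \<omega>)"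
    using \<omega>(1) by (intro ln_mono) auto
  finally have "(\<beta>\<^sup>2 * real N - ln 2) / real N \<le> F \<omega>"
    unfolding FZ by (intro divide_right_mono) auto
  then have "\<beta>\<^sup>2 - ln 2 / real N \<le> F \<omega>"
    using \<open>0 < N\<close> by (simp add: diff_divide_distrib)
  with \<omega>(2) N1 have m: "\<beta>\<^sup>2 - 2 * \<epsilon> \<le> ?m"
    by linarith
  \<comment> \<open>The mean is at least \<open>\<beta>\<^sup>2 - 2 * \<epsilon>\<close>, so a value
    of \<open>F\<close> below \<open>\<beta>\<^sup>2 - 3 * \<epsilon>\<close> is at distance at
    least \<open>\<epsilon>\<close> from it. A value that is too large forces \<open>Z\<close> above
    \<open>exp (\<epsilon> * N)\<close> times its expectation, where Markov's inequality
    applies.\<close>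
  have "{\<omega> \<in> space M. \<bar>F \<omega> - \<beta>\<^sup>2\<bar> > 3 * \<epsilon>} \<subseteq> ?D \<union> ?U"
  proof
    fix \<omega> assume *: "\<omega> \<in> {\<omega> \<in> space M. \<bar>F \<omega> - \<beta>\<^sup>2\<bar> > 3 * \<epsilon>}"
    show "\<omega> \<in> ?D \<union> ?U"
    proof (cases "F \<omega> < \<beta>\<^sup>2")
      case True
      with * m show ?thesis by auto
    next
      case False
      with * \<open>0 < \<epsilon>\<close> have "\<epsilon> + \<beta>\<^sup>2 \<le> ln (Z \<omega>) / real N"
        by (simp add: FZ)
      then have "exp (\<epsilon> * real N + \<beta>\<^sup>2 * real N) \<le> exp (ln (Z \<omega>))"
        using \<open>0 < N\<close> by (simp add: pos_le_divide_eq distrib_right)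
      then show ?thesis
        using * Z_pos[of \<omega>] by (simp add: exp_add)
    qed
  qed
  then have "prob {\<omega> \<in> space M. \<bar>F \<omega> - \<beta>\<^sup>2\<bar> > 3 * \<epsilon>} \<le> prob (?D \<union> ?U)"
    by (intro finite_measure_mono) auto
  also have "\<dots> \<le> prob ?D + prob ?U"
    by (intro measure_Un_le) auto
  also have "prob ?U \<le> expectation Z / (exp (\<epsilon> * real N) * exp (\<beta>\<^sup>2 * real N))"
    using Z_pos by (intro integral_Markov_inequality_measure[OF Z1, of "{}"]) (auto intro!: AE_I2 less_imp_le)
  also have "\<dots> = exp (- \<epsilon> * real N)"
    by (simp add: EZ exp_minus field_simps)
  finally show ?thesis
    using D by simp
qed

section \<open>Passage to the limit\<close>

theorem corollary2p1:
  fixes M :: "nat \<Rightarrow> 'a measure"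
    and W :: "nat \<Rightarrow> nat \<Rightarrow> nat \<Rightarrow> 'a \<Rightarrow> real"
    and \<beta> :: real
  assumes "\<And>N. GOE N (M N) (W N)"
    and "0 \<le> \<beta>" and "\<beta> < 1 / 2"
  shows "tendsto_in_prob M
    (\<lambda>N \<omega>. free_energy N \<beta> (normalized N (\<lambda>i j. W N i j \<omega>))) (\<beta>\<^sup>2)"
  unfolding tendsto_in_prob_def
proof (intro conjI allI impI)
  show "(\<lambda>\<omega>. free_energy N \<beta> (normalized N (\<lambda>i j. W N i j \<omega>))) \<in> borel_measurable (M N)" for N
    using assms(1) by (rule free_energy_measurable)
next
  fix \<epsilon> :: real assume "0 < \<epsilon>"
  \<comment> \<open>The deviation bound is for three times its parameter.\<close>
  define \<delta> where "\<delta> = \<epsilon> / 3"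
  have \<delta>: "0 < \<delta>" "\<epsilon> = 3 * \<delta>"
    using \<open>0 < \<epsilon>\<close> by (auto simp: \<delta>_def)
  have "\<beta>\<^sup>2 < (1 / 2)\<^sup>2"
    using assms by (intro power_strict_mono) auto
  then have \<beta>: "4 * \<beta>\<^sup>2 < 1"
    by (simp add: power_divide)
  have "(\<lambda>N. ln 2 / real N) \<longlonglongrightarrow> 0"
    by real_asymp
  then have ev1: "\<forall>\<^sub>F N in sequentially. ln 2 / real N < \<delta>"
    using \<delta>(1) by (rule order_tendstoD)
  have lim2: "(\<lambda>N. 8 * \<beta>\<^sup>2 / real N / \<delta>\<^sup>2) \<longlonglongrightarrow> 0"
    using tendsto_mult_right_zero[OF lim_inverse_n, of "8 * \<beta>\<^sup>2 / \<delta>\<^sup>2"] by (simp add: field_simps)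
  have ev2: "\<forall>\<^sub>F N in sequentially. 8 * \<beta>\<^sup>2 / real N / \<delta>\<^sup>2 < 1 / (4 * exp (2 * \<beta>\<^sup>2 / (1 - 4 * \<beta>\<^sup>2)))"
    by (rule order_tendstoD(2)[OF lim2]) simp
  \<comment> \<open>The threshold in \<open>ev2\<close> does not depend on \<open>N\<close>, so for
    large \<open>N\<close> all hypotheses of the deviation bound hold; its right-hand side tends to
    0.\<close>
  have "\<forall>\<^sub>F N in sequentially.
      measure (M N) {\<omega> \<in> space (M N). \<bar>free_energy N \<beta> (normalized N (\<lambda>i j. W N i j \<omega>)) - \<beta>\<^sup>2\<bar> > \<epsilon>}
      \<le> 8 * \<beta>\<^sup>2 / real N / \<delta>\<^sup>2 + exp (- \<delta> * real N)"
    using ev1 ev2 eventually_gt_at_top[of 0] unfolding \<delta>(2)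
  proof eventually_elim
    case (elim N)
    then show ?case
      using \<delta>(1) \<beta> assms(2) by (intro free_energy_deviation[OF assms(1)]) auto
  qed
  moreover have "(\<lambda>N. exp (- \<delta> * real N)) \<longlonglongrightarrow> 0"
    using \<delta>(1) by real_asymp
  with lim2 have "(\<lambda>N. 8 * \<beta>\<^sup>2 / real N / \<delta>\<^sup>2 + exp (- \<delta> * real N)) \<longlonglongrightarrow> 0"
    using tendsto_add_zero by blast
  ultimately show "(\<lambda>N. measure (M N) {\<omega> \<in> space (M N).
      \<bar>free_energy N \<beta> (normalized N (\<lambda>i j. W N i j \<omega>)) - \<beta>\<^sup>2\<bar> > \<epsilon>}) \<longlonglongrightarrow> 0"
    by (rule tendsto_sandwich[OF always_eventually[OF allI[OF measure_nonneg]] _ tendsto_const])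
qed

end
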